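(* The complete graph $K_5$ and the complete bipartite graph $K_{3,3}$ both admit cycle $M$-bases.
   Context: Let $G=(V,E)$ be a finite connected undirected simple graph with a fixed orientation of its edges, and let $\partial : \mathbb{R}^E \to \mathbb{R}^V$ be the signed incidence matrix: the column of an edge has an entry $-1$ in the row of one endpoint and $+1$ in the row of the other endpoint (according to the orientation), and $0$ elsewhere. The lattice of integral flows of $G$ is $\mathcal{F}(G) = \mathbb{Z}^E \cap \ker(\partial)$, a free abelian group of rank $g = |E|-|V|+1$. Given a $\mathbb{Z}$-basis $\mathcal{B} = \{\mathbf{f}_1,\dots,\mathbf{f}_g\}$ of $\mathcal{F}(G)$, let $\iota$ be the $|E|\times g$ matrix with columns $\mathbf{f}_1,\dots,\mathbf{f}_g$; the associated dual Laplacian is $\mathcal{L}^* = \iota^T\iota$. An $n\times n$ matrix $L$ is a $Z$-matrix if $L_{ij}\le 0$ for all $i\ne j$. A $Z$-matrix $L$ is a (non-singular) $M$-matrix if all eigenvalues of $L$ have positive real part (equivalently, $L^{-1}$ exists and has all entries non-negative). $\mathcal{B}$ is an integral flow $M$-basis if $\mathcal{L}^*$ is an $M$-matrix. A cycle $M$-basis for $G$ is an integral flow $M$-basis each of whose elements encodes a directed (simple) cycle of $G$: all entries are in $\{0,1,-1\}$, the nonzero entries are exactly those at the edges of some simple cycle of $G$, and the signs are determined by comparing a cyclic orientation of that cycle with the fixed orientation of $G$ ($+1$ if they agree on the edge, $-1$ if they disagree). *)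

theory Defs
  imports
    "Graph_Theory.Kuratowski"
    "Jordan_Normal_Form.Char_Poly"
    "HOL-Library.Function_Algebras"
    Complex_Main
begin

text \<open>
  Undirected simple graphs are those of the locale \<^locale>\<open>graph\<close>: symmetric digraphs in which every
  edge is represented by two mutually reverse arcs. An orientation is a set \<open>E\<close> of arcs that contains
  exactly one of the two arcs of every edge. Its elements serve as the index set of the coordinates
  of \<open>\<real>\<^sup>E\<close>; a vector is a function on arcs that vanishes outside \<open>E\<close>.
\<close>

definition reverse_arcs :: "('a, 'b) pre_digraph \<Rightarrow> 'b \<Rightarrow> 'b \<Rightarrow> bool" where
  "reverse_arcs G e e' \<longleftrightarrow> tail G e' = head G e \<and> head G e' = tail G e"

definition orientation :: "('a, 'b) pre_digraph \<Rightarrow> 'b set \<Rightarrow> bool" where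
  "orientation G E \<longleftrightarrow> E \<subseteq> arcs G \<and>
     (\<forall>e\<in>arcs G. \<forall>e'\<in>arcs G. reverse_arcs G e e' \<longrightarrow> (e \<in> E \<longleftrightarrow> e' \<notin> E))"

definition incidence :: "('a, 'b) pre_digraph \<Rightarrow> 'a \<Rightarrow> 'b \<Rightarrow> real" where
  "incidence G v e = (if v = tail G e then -1 else if v = head G e then 1 else 0)"

definition boundary :: "('a, 'b) pre_digraph \<Rightarrow> 'b set \<Rightarrow> ('b \<Rightarrow> real) \<Rightarrow> 'a \<Rightarrow> real" where
  "boundary G E f v = (\<Sum>e\<in>E. incidence G v e * f e)"

definition integral_flows :: "('a, 'b) pre_digraph \<Rightarrow> 'b set \<Rightarrow> ('b \<Rightarrow> real) set" where
  "integral_flows G E =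
     {f. (\<forall>e\<in>E. f e \<in> \<int>) \<and> (\<forall>e. e \<notin> E \<longrightarrow> f e = 0) \<and> (\<forall>v\<in>verts G. boundary G E f v = 0)}"

definition int_scale :: "int \<Rightarrow> ('b \<Rightarrow> real) \<Rightarrow> 'b \<Rightarrow> real" where
  "int_scale c f = (\<lambda>e. of_int c * f e)"

global_interpretation int_mod: Modules.module int_scale
  by unfold_locales (auto simp: int_scale_def fun_eq_iff algebra_simps)

text \<open>Bases are ordered, since the dual Laplacian is a matrix.\<close>

definition integral_flow_basis ::
    "('a, 'b) pre_digraph \<Rightarrow> 'b set \<Rightarrow> ('b \<Rightarrow> real) list \<Rightarrow> bool" where
  "integral_flow_basis G E fs \<longleftrightarrow> distinct fs \<and>
     int_mod.independent (set fs) \<and> int_mod.span (set fs) = integral_flows G E"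

text \<open>
  The entries of \<open>\<iota>\<^sup>T \<iota>\<close>, where the matrix \<open>\<iota>\<close>, with rows indexed by \<open>E\<close>, has
  the elements of \<open>fs\<close> as its columns.
\<close>

definition dual_Laplacian :: "'b set \<Rightarrow> ('b \<Rightarrow> real) list \<Rightarrow> real mat" where
  "dual_Laplacian E fs =
     mat (length fs) (length fs) (\<lambda>(i, j). \<Sum>e\<in>E. (fs ! i) e * (fs ! j) e)"

definition Z_matrix :: "real mat \<Rightarrow> bool" where
  "Z_matrix L \<longleftrightarrow> square_mat L \<and>
     (\<forall>i<dim_row L. \<forall>j<dim_col L. i \<noteq> j \<longrightarrow> L $$ (i, j) \<le> 0)"

definition M_matrix :: "real mat \<Rightarrow> bool" where
  "M_matrix L \<longleftrightarrow> Z_matrix L \<and> (\<forall>k. eigenvalue (map_mat complex_of_real L) k \<longrightarrow> Re k > 0)"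

definition integral_flow_M_basis ::
    "('a, 'b) pre_digraph \<Rightarrow> 'b set \<Rightarrow> ('b \<Rightarrow> real) list \<Rightarrow> bool" where
  "integral_flow_M_basis G E fs \<longleftrightarrow>
     integral_flow_basis G E fs \<and> M_matrix (dual_Laplacian E fs)"

text \<open>
  As a list of arcs, \<open>p\<close> is a cycle together with a cyclic orientation. The bound on the length
  excludes traversing a single edge back and forth, which is a cycle of the symmetric digraph
  but not of the undirected graph.
\<close>

definition encodes_directed_cycle ::
    "('a, 'b) pre_digraph \<Rightarrow> 'b set \<Rightarrow> ('b \<Rightarrow> real) \<Rightarrow> bool" where
  "encodes_directed_cycle G E f \<longleftrightarrow>
     (\<exists>p. pre_digraph.cycle G p \<and> 3 \<le> length p \<and>
       (\<forall>e. f e = (if e \<in> E \<and> e \<in> set p then 1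
                   else if e \<in> E \<and> (\<exists>e'\<in>set p. reverse_arcs G e e') then -1
                   else 0)))"

definition cycle_M_basis ::
    "('a, 'b) pre_digraph \<Rightarrow> 'b set \<Rightarrow> ('b \<Rightarrow> real) list \<Rightarrow> bool" where
  "cycle_M_basis G E fs \<longleftrightarrow>
     integral_flow_M_basis G E fs \<and> (\<forall>f\<in>set fs. encodes_directed_cycle G E f)"

definition admits_cycle_M_basis :: "('a, 'b) pre_digraph \<Rightarrow> bool" where
  "admits_cycle_M_basis G \<longleftrightarrow> (\<forall>E. orientation G E \<longrightarrow> (\<exists>fs. cycle_M_basis G E fs))"

end

theory Submission
  imports Defs
begin

text \<open>
  A Gram matrix of linearly independent real vectors is positive definite, so its eigenvalues are
  positive, and being an \<open>M\<close>-matrix only requires the vectors to meet pairwise at non-acute angles.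
  The task is therefore to exhibit cycles with pairwise non-positive inner products that form a
  \<open>\<int>\<close>-basis of the flows. The basis property is certified by integral functionals dual to the
  cycles whose common kernel contains no nonzero flow: they give linear independence over \<open>\<real>\<close>, and
  their values on an integral flow are its integer coordinates. Changing the orientation only changes
  signs of coordinates, which preserves all inner products.
\<close>

section \<open>Lattice bases from dual integral functionals\<close>

lemma sum_apply: "(\<Sum>x\<in>A. F x) e = (\<Sum>x\<in>A. F x e)"
  by (induction A rule: infinite_finite_induct) auto

lemma subspace_integral_flows: "int_mod.subspace (integral_flows G E)"
proof (rule int_mod.subspaceI)
  fix f g assume "f \<in> integral_flows G E" "g \<in> integral_flows G E"
  then show "f + g \<in> integral_flows G E"
    by (auto simp: integral_flows_def boundary_def distrib_left sum.distrib)
next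
  fix c f assume "f \<in> integral_flows G E"
  moreover have "boundary G E (int_scale c f) v = of_int c * boundary G E f v" for v
    by (simp add: boundary_def int_scale_def sum_distrib_left mult.left_commute)
  ultimately show "int_scale c f \<in> integral_flows G E"
    by (auto simp: integral_flows_def) (auto simp: int_scale_def)
qed (auto simp: integral_flows_def boundary_def)

text \<open>The weights have type \<open>int\<close>, so the functionals take integer values on
  integral flows.\<close>

definition dual_functionals ::
    "'b set \<Rightarrow> ('b \<Rightarrow> real) list \<Rightarrow> (nat \<Rightarrow> 'b \<Rightarrow> int) \<Rightarrow> bool" where
  "dual_functionals E fs m \<longleftrightarrow>
     (\<forall>i<length fs. \<forall>j<length fs. (\<Sum>e\<in>E. m i e * (fs ! j) e) = (if i = j then 1 else 0))"

text \<open>For spanning, subtract from a flow the combination whose coefficients are its functional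
  values. The remainder is a flow killed by every functional, hence zero by
  \<open>separating\<close>.\<close>

lemma integral_flow_basis_if_dual_functionals:
  assumes flows: "set fs \<subseteq> integral_flows G E"
    and dual: "dual_functionals E fs m"
    and separating: "\<And>f e. \<lbrakk>f \<in> integral_flows G E; \<forall>i<length fs. (\<Sum>e\<in>E. m i e * f e) = 0; e \<in> E\<rbrakk>
      \<Longrightarrow> f e = 0"
  shows "integral_flow_basis G E fs"
proof -
  \<comment> \<open>Equal entries at different positions would give one functional both values 1 and
    0 on the same vector.\<close>
  have "distinct fs"
    unfolding distinct_conv_nth using dual unfolding dual_functionals_def
    by (metis zero_neq_one)
  moreover have "int_mod.independent (set fs)"
    unfolding int_mod.dependent_finite[OF finite_set]
  proof safe
    fix u f assume zero: "(\<Sum>v\<in>set fs. int_scale (u v) v) = 0" and "f \<in> set fs" "u f \<noteq> 0"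
    then obtain i where i: "i < length fs" "f = fs ! i" by (metis in_set_conv_nth)
    have pair: "(\<Sum>e\<in>E. m i e * v e) = (if v = f then 1 else 0)" if "v \<in> set fs" for v :: "_ \<Rightarrow> real"
      using dual \<open>distinct fs\<close> i that unfolding dual_functionals_def
      by (auto simp: in_set_conv_nth nth_eq_iff_index_eq)
    \<comment> \<open>The functional dual to \<open>f\<close> isolates the coefficient
      \<open>u f\<close> in the relation.\<close>
    have "0 = (\<Sum>e\<in>E. m i e * (\<Sum>v\<in>set fs. int_scale (u v) v) e)"
      unfolding zero by simp
    also have "\<dots> = (\<Sum>v\<in>set fs. u v * (\<Sum>e\<in>E. m i e * v e))"
      unfolding sum_apply int_scale_def sum_distrib_left by (subst sum.swap) (simp add: mult_ac)
    also have "\<dots> = (\<Sum>v\<in>set fs. if v = f then real_of_int (u v) else 0)"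
      by (intro sum.cong refl) (simp add: pair)
    also have "\<dots> = u f" using \<open>f \<in> set fs\<close> by simp
    finally show False using \<open>u f \<noteq> 0\<close> by simp
  qed
  moreover have "int_mod.span (set fs) = integral_flows G E"
  proof
    show "int_mod.span (set fs) \<subseteq> integral_flows G E"
      using flows subspace_integral_flows by (rule int_mod.span_minimal)
    show "integral_flows G E \<subseteq> int_mod.span (set fs)"
    proof
      fix f assume f: "f \<in> integral_flows G E"
      then have "(\<Sum>e\<in>E. m i e * f e) \<in> \<int>" for i
        unfolding integral_flows_def by (auto intro!: Ints_mult)
      then have "\<exists>k. (\<Sum>e\<in>E. m i e * f e) = of_int k" for i by (rule Ints_cases) blast
      then obtain c where c: "\<And>i. (\<Sum>e\<in>E. m i e * f e) = of_int (c i)" by metis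
      define g where "g = (\<Sum>i<length fs. int_scale (c i) (fs ! i))"
      have g: "g \<in> int_mod.span (set fs)"
        unfolding g_def by (intro int_mod.span_sum int_mod.span_scale int_mod.span_base) auto
      then have "g \<in> integral_flows G E"
        using \<open>int_mod.span (set fs) \<subseteq> integral_flows G E\<close> by blast
      with f have diff: "f - g \<in> integral_flows G E"
        by (rule int_mod.subspace_diff[OF subspace_integral_flows])
      have "(\<Sum>e\<in>E. m i e * (f - g) e) = 0" if "i < length fs" for i
      proof -
        have "(\<Sum>e\<in>E. m i e * g e) = (\<Sum>j<length fs. c j * (\<Sum>e\<in>E. m i e * (fs ! j) e))"
          unfolding g_def sum_apply int_scale_def sum_distrib_left
          by (subst sum.swap) (simp add: mult_ac)
        also have "\<dots> = (\<Sum>j<length fs. if i = j then real_of_int (c j) else 0)"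
          using dual that unfolding dual_functionals_def by (intro sum.cong refl) simp
        also have "\<dots> = c i" using that by simp
        finally show ?thesis using c by (simp add: right_diff_distrib sum_subtractf)
      qed
      \<comment> \<open>On \<open>E\<close> this is \<open>separating\<close>; off \<open>E\<close>
        flows vanish by definition.\<close>
      with separating[OF diff] have "(f - g) e = 0" for e
        using diff unfolding integral_flows_def by blast
      then have "f = g" by (auto simp: fun_eq_iff)
      with g show "f \<in> int_mod.span (set fs)" by simp
    qed
  qed
  ultimately show ?thesis unfolding integral_flow_basis_def by blast
qed

section \<open>Eigenvalues of a Gram matrix\<close>

text \<open>
  For an eigenvector \<open>w\<close> with eigenvalue \<open>k\<close>, the Hermitian form \<open>w\<^sup>* L w\<close> is both
  \<open>k * \<parallel>w\<parallel>\<^sup>2\<close> and \<open>\<parallel>\<iota> w\<parallel>\<^sup>2\<close>.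
\<close>

lemma M_matrix_dual_Laplacian:
  assumes dual: "dual_functionals E fs m" and "finite E"
    and obtuse: "\<And>i j. \<lbrakk>i < length fs; j < length fs; i \<noteq> j\<rbrakk> \<Longrightarrow> (\<Sum>e\<in>E. (fs ! i) e * (fs ! j) e) \<le> 0"
  shows "M_matrix (dual_Laplacian E fs)"
  unfolding M_matrix_def
proof (intro conjI allI impI)
  show "Z_matrix (dual_Laplacian E fs)"
    using obtuse by (auto simp: Z_matrix_def dual_Laplacian_def)
next
  fix k :: complex
  let ?n = "length fs" and ?L = "map_mat complex_of_real (dual_Laplacian E fs)"
  assume "eigenvalue ?L k"
  then obtain w where w: "w \<in> carrier_vec ?n" "w \<noteq> 0\<^sub>v ?n" "?L *\<^sub>v w = k \<cdot>\<^sub>v w"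
    unfolding eigenvalue_def eigenvector_def by (auto simp: dual_Laplacian_def)
  \<comment> \<open>\<open>W\<close> is the image of \<open>w\<close> under \<iota>;
    \<open>N\<close> and \<open>S\<close> are the squared norms of \<open>w\<close> and
    \<open>W\<close>.\<close>
  define W where "W e = (\<Sum>j<?n. w $ j * (fs ! j) e)" for e
  define N where "N = (\<Sum>j<?n. (cmod (w $ j))\<^sup>2)"
  define S where "S = (\<Sum>e\<in>E. (cmod (W e))\<^sup>2)"
  have row: "(\<Sum>e\<in>E. (fs ! i) e * W e) = k * w $ i" if "i < ?n" for i
  proof -
    have "k * w $ i = (?L *\<^sub>v w) $ i" using w that by simp
    also have "\<dots> = (\<Sum>j<?n. (\<Sum>e\<in>E. (fs ! i) e * (fs ! j) e) * w $ j)"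
      using w(1) that by (simp add: dual_Laplacian_def scalar_prod_def lessThan_atLeast0)
    also have "\<dots> = (\<Sum>e\<in>E. (fs ! i) e * W e)"
      unfolding W_def of_real_sum sum_distrib_right sum_distrib_left
      by (subst sum.swap) (simp add: mult_ac)
    finally show ?thesis by simp
  qed
  have "complex_of_real S = (\<Sum>e\<in>E. cnj (W e) * W e)"
    unfolding S_def of_real_sum by (intro sum.cong refl) (simp add: complex_norm_square mult.commute del: of_real_power)
  \<comment> \<open>Only the conjugated \<open>W e\<close> is expanded, so that \<open>row\<close>
    applies to the other factor.\<close>
  also have "\<dots> = (\<Sum>i<?n. cnj (w $ i) * (\<Sum>e\<in>E. (fs ! i) e * W e))"
    unfolding W_def[of _, THEN arg_cong[where f = cnj]] cnj_sum sum_distrib_right sum_distrib_left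
    by (subst sum.swap) (simp add: mult_ac)
  also have "\<dots> = (\<Sum>i<?n. cnj (w $ i) * (k * w $ i))"
    by (intro sum.cong refl) (simp only: row lessThan_iff)
  also have "\<dots> = k * N"
    unfolding N_def of_real_sum sum_distrib_left
    by (intro sum.cong refl) (simp add: complex_norm_square mult_ac del: of_real_power)
  finally have "complex_of_real S = k * N" .
  then have "S = Re k * N" by (metis Re_complex_of_real times_complex.simps(1) Im_complex_of_real mult_zero_right diff_zero)
  moreover have "N > 0"
  proof -
    obtain i where "i < ?n" "w $ i \<noteq> 0" using w by (metis carrier_vecD eq_vecI index_zero_vec)
    then show ?thesis unfolding N_def by (intro sum_pos2[of _ i]) auto
  qed
  moreover have "S > 0"
  proof (rule ccontr)
    assume "\<not> S > 0"
    then have "S = 0" unfolding S_def by (smt (verit) sum_nonneg zero_le_power2)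
    then have W: "W e = 0" if "e \<in> E" for e
      using that \<open>finite E\<close> unfolding S_def by (simp add: sum_nonneg_eq_0_iff)
    have "w $ i = 0" if i: "i < ?n" for i
    proof -
      \<comment> \<open>The functional dual to \<open>fs ! i\<close> reads the coordinate
        \<open>w $ i\<close> off \<open>W\<close>, which gives linear independence over the complex
        numbers as well.\<close>
      have "0 = (\<Sum>e\<in>E. m i e * W e)" using W by simp
      also have "\<dots> = (\<Sum>j<?n. w $ j * of_real (\<Sum>e\<in>E. m i e * (fs ! j) e))"
        unfolding W_def of_real_sum sum_distrib_left by (subst sum.swap) (simp add: mult_ac)
      also have "\<dots> = (\<Sum>j<?n. if i = j then w $ j else 0)"
        using dual i unfolding dual_functionals_def by (intro sum.cong refl) simp
      finally show ?thesis using i by simp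
    qed
    with w show False by (metis carrier_vecD eq_vecI index_zero_vec)
  qed
  ultimately show "Re k > 0" by (metis zero_less_mult_pos2)
qed

section \<open>Closed vertex sequences and their flows\<close>

definition steps :: "nat list \<Rightarrow> (nat \<times> nat) set" where
  "steps c = set (zip c (rotate1 c))"

text \<open>Integer-valued, like \<open>net\<close>, so that identities can be evaluated over
  \<open>int\<close> and cast to the reals afterwards.\<close>

definition cycle_flow :: "nat list \<Rightarrow> nat \<times> nat \<Rightarrow> int" where
  "cycle_flow c p = of_bool (p \<in> steps c) - of_bool (prod.swap p \<in> steps c)"

definition net :: "nat \<Rightarrow> nat \<times> nat \<Rightarrow> int" where
  "net v p = (if v = fst p then -1 else if v = snd p then 1 else 0)"

section \<open>Translation between an orientation and labelled edges\<close>

text \<open>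
  The set \<open>A\<close> contains every undirected edge once, with the endpoint of smaller label first. So
  \<open>\<real>\<^sup>A\<close> belongs to a reference orientation, and \<open>lift\<close> below translates from it to \<open>E\<close>.
\<close>

locale labelled_orientation = graph G for G :: "('a, 'b) pre_digraph" +
  fixes E :: "'b set" and n :: nat and \<phi> :: "nat \<Rightarrow> 'a" and A :: "(nat \<times> nat) set"
  assumes orientation: "orientation G E"
    and bij_\<phi>: "bij_betw \<phi> {..<n} (verts G)"
    and increasing: "(i, j) \<in> A \<Longrightarrow> i < j \<and> j < n"
    and adjacent: "\<lbrakk>i < n; j < n\<rbrakk> \<Longrightarrow> \<phi> i \<rightarrow>\<^bsub>G\<^esub> \<phi> j \<longleftrightarrow> (i, j) \<in> A \<or> (j, i) \<in> A"
begin

definition src :: "'b \<Rightarrow> nat" where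
  "src e = inv_into {..<n} \<phi> (tail G e)"

definition tgt :: "'b \<Rightarrow> nat" where
  "tgt e = inv_into {..<n} \<phi> (head G e)"

definition sign :: "'b \<Rightarrow> int" where
  "sign e = (if src e < tgt e then 1 else -1)"

definition edge :: "'b \<Rightarrow> nat \<times> nat" where
  "edge e = (min (src e) (tgt e), max (src e) (tgt e))"

definition lift :: "(nat \<times> nat \<Rightarrow> real) \<Rightarrow> 'b \<Rightarrow> real" where
  "lift X e = (if e \<in> E then real_of_int (sign e) * X (edge e) else 0)"

lemma \<phi>_eq_iff: "\<lbrakk>i < n; j < n\<rbrakk> \<Longrightarrow> \<phi> i = \<phi> j \<longleftrightarrow> i = j"
  using bij_\<phi> by (auto simp: bij_betw_def inj_on_def)

lemma E_subset_arcs: "e \<in> E \<Longrightarrow> e \<in> arcs G"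
  using orientation by (auto simp: orientation_def)

lemma finite_E: "finite E"
  using E_subset_arcs finite_arcs by (meson finite_subset subsetI)

lemma
  assumes "e \<in> arcs G"
  shows src_less: "src e < n" and tgt_less: "tgt e < n"
    and \<phi>_src: "\<phi> (src e) = tail G e" and \<phi>_tgt: "\<phi> (tgt e) = head G e"
  using assms bij_\<phi> tail_in_verts[of e] head_in_verts[of e]
    inv_into_into[of _ \<phi> "{..<n}"] f_inv_into_f[of _ \<phi> "{..<n}"]
  by (auto simp: src_def tgt_def bij_betw_def)

lemma src_neq_tgt: "e \<in> arcs G \<Longrightarrow> src e \<noteq> tgt e"
  using no_loops \<phi>_src \<phi>_tgt by metis

lemma src_tgt_in_A: "e \<in> arcs G \<Longrightarrow> (src e, tgt e) \<in> A \<or> (tgt e, src e) \<in> A"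
  by (metis \<phi>_src \<phi>_tgt adjacent dominatesI arc_to_ends_def src_less tgt_less)

lemma arc_eqI: "\<lbrakk>e \<in> arcs G; e' \<in> arcs G; src e = src e'; tgt e = tgt e'\<rbrakk> \<Longrightarrow> e = e'"
  by (metis \<phi>_src \<phi>_tgt arc_to_ends_def no_multi_arcs)

lemma reverse_arcs_iff:
  "\<lbrakk>e \<in> arcs G; e' \<in> arcs G\<rbrakk> \<Longrightarrow> reverse_arcs G e e' \<longleftrightarrow> src e' = tgt e \<and> tgt e' = src e"
  unfolding reverse_arcs_def by (metis \<phi>_src \<phi>_tgt \<phi>_eq_iff src_less tgt_less)

lemma ex_arc:
  assumes "(i, j) \<in> A \<or> (j, i) \<in> A"
  obtains e where "e \<in> arcs G" "src e = i" "tgt e = j"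
proof -
  have "i < n" "j < n" using assms increasing by fastforce+
  with assms have "\<phi> i \<rightarrow>\<^bsub>G\<^esub> \<phi> j" using adjacent by blast
  then obtain e where "e \<in> arcs G" "tail G e = \<phi> i" "head G e = \<phi> j" by (rule reachableE)
  with \<open>i < n\<close> \<open>j < n\<close> show ?thesis
    using that by (metis \<phi>_src \<phi>_tgt \<phi>_eq_iff src_less tgt_less)
qed

text \<open>Arcs with the same \<open>edge\<close> are equal or mutually reverse. An orientation
  contains at most one of two reverse arcs, which gives injectivity, and at least one, which gives
  surjectivity.\<close>

lemma bij_betw_edge: "bij_betw edge E A"
proof (rule bij_betw_imageI)
  show "inj_on edge E"
  proof (rule inj_onI)
    fix e e' assume e: "e \<in> E" "e' \<in> E" and "edge e = edge e'"
    then consider "src e = src e'" "tgt e = tgt e'" | "src e = tgt e'" "tgt e = src e'"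
      unfolding edge_def by (metis min_def max_def prod.inject)
    then show "e = e'"
    proof cases
      case 2
      then have "reverse_arcs G e e'" using e E_subset_arcs reverse_arcs_iff by auto
      then show ?thesis using e E_subset_arcs orientation unfolding orientation_def by blast
    qed (use e E_subset_arcs arc_eqI in blast)
  qed
  show "edge ` E = A"
  proof
    show "edge ` E \<subseteq> A"
      using src_tgt_in_A[OF E_subset_arcs] increasing
      by (auto simp: edge_def min_def max_def) force+
    show "A \<subseteq> edge ` E"
    proof safe
      fix i j assume ij: "(i, j) \<in> A"
      obtain e where e: "e \<in> arcs G" "src e = i" "tgt e = j" using ij ex_arc by blast
      obtain e' where e': "e' \<in> arcs G" "src e' = j" "tgt e' = i" using ij ex_arc by blast
      have "e \<in> E \<or> e' \<in> E"
        using e e' orientation reverse_arcs_iff unfolding orientation_def by blast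
      moreover have "edge e = (i, j)" "edge e' = (i, j)"
        using e e' increasing[OF ij] by (auto simp: edge_def)
      ultimately show "(i, j) \<in> edge ` E" by (metis image_eqI)
    qed
  qed
qed

text \<open>Each sign occurs twice and cancels, so inner products do not depend on the
  orientation.\<close>

lemma sum_lift:
  fixes X Y :: "nat \<times> nat \<Rightarrow> real"
  shows "(\<Sum>e\<in>E. lift X e * lift Y e) = (\<Sum>p\<in>A. X p * Y p)"
  unfolding sum.reindex_bij_betw[OF bij_betw_edge, symmetric]
  by (intro sum.cong refl) (simp add: lift_def sign_def)

text \<open>Reversing an arc negates both its incidence column and its coordinate.\<close>

lemma boundary_lift:
  fixes X :: "nat \<times> nat \<Rightarrow> real"
  assumes "v < n"
  shows "boundary G E (lift X) (\<phi> v) = (\<Sum>p\<in>A. net v p * X p)"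
  unfolding boundary_def sum.reindex_bij_betw[OF bij_betw_edge, symmetric]
proof (intro sum.cong refl)
  fix e assume e: "e \<in> E"
  note arc = E_subset_arcs[OF e]
  show "incidence G (\<phi> v) e * lift X e = net v (edge e) * X (edge e)"
    using e src_neq_tgt[OF arc] assms \<phi>_src[OF arc, symmetric] \<phi>_tgt[OF arc, symmetric]
      src_less[OF arc] tgt_less[OF arc]
    by (auto simp: incidence_def lift_def sign_def edge_def net_def \<phi>_eq_iff)
qed

text \<open>This turns membership into a condition that mentions neither \<open>G\<close> nor
  \<open>E\<close>.\<close>

lemma lift_in_integral_flows_iff:
  fixes X :: "nat \<times> nat \<Rightarrow> real"
  shows "lift X \<in> integral_flows G E \<longleftrightarrow> (\<forall>p\<in>A. X p \<in> \<int>) \<and> (\<forall>v<n. (\<Sum>p\<in>A. net v p * X p) = 0)"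
proof -
  have "(\<forall>v\<in>verts G. boundary G E (lift X) v = 0) \<longleftrightarrow> (\<forall>v<n. (\<Sum>p\<in>A. net v p * X p) = 0)"
    unfolding bij_betw_imp_surj_on[OF bij_\<phi>, symmetric] by (auto simp: boundary_lift)
  moreover have "(\<forall>e\<in>E. lift X e \<in> \<int>) \<longleftrightarrow> (\<forall>p\<in>A. X p \<in> \<int>)"
    using bij_betw_edge by (auto simp: lift_def sign_def bij_betw_def)
  ultimately show ?thesis by (auto simp: integral_flows_def lift_def)
qed

lemma ex_lift:
  fixes f :: "'b \<Rightarrow> real"
  assumes "\<And>e. e \<notin> E \<Longrightarrow> f e = 0"
  obtains X where "f = lift X"
proof
  \<comment> \<open>A sign is its own inverse, so the same factor undoes
    \<open>lift\<close>.\<close>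
  show "f = lift (\<lambda>p. sign (inv_into E edge p) * f (inv_into E edge p))"
    using assms bij_betw_edge
    by (auto simp: fun_eq_iff lift_def sign_def bij_betw_def inv_into_f_f)
qed

text \<open>Choosing an arc over each step yields a closed walk; it is simple because the labels in
  \<open>c\<close> are distinct and \<open>\<phi>\<close> is injective on them.\<close>

lemma encodes_directed_cycle_lift:
  assumes "distinct c" "3 \<le> length c"
    and steps: "\<And>i j. (i, j) \<in> steps c \<Longrightarrow> (j, i) \<notin> steps c \<and> ((i, j) \<in> A \<or> (j, i) \<in> A)"
  shows "encodes_directed_cycle G E (lift (\<lambda>p. cycle_flow c p))"
proof -
  have "\<forall>p\<in>steps c. \<exists>e. e \<in> arcs G \<and> src e = fst p \<and> tgt e = snd p"
  proof
    fix p assume "p \<in> steps c"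
    then have "(fst p, snd p) \<in> A \<or> (snd p, fst p) \<in> A" using steps[of "fst p" "snd p"] by simp
    then show "\<exists>e. e \<in> arcs G \<and> src e = fst p \<and> tgt e = snd p" using ex_arc by metis
  qed
  from bchoice[OF this] obtain \<alpha>
    where \<alpha>: "\<And>p. p \<in> steps c \<Longrightarrow> \<alpha> p \<in> arcs G \<and> src (\<alpha> p) = fst p \<and> tgt (\<alpha> p) = snd p"
    by blast
  define p where "p = map \<alpha> (zip c (rotate1 c))"
  \<comment> \<open>Without parallel arcs the choice \<open>\<alpha>\<close> is forced, so
    \<open>p\<close> consists of all arcs lying over steps of \<open>c\<close>.\<close>
  have set_p: "e \<in> set p \<longleftrightarrow> e \<in> arcs G \<and> (src e, tgt e) \<in> steps c" for e
  proof
    assume "e \<in> set p"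
    then obtain q where "q \<in> steps c" "e = \<alpha> q" by (auto simp: p_def steps_def)
    then show "e \<in> arcs G \<and> (src e, tgt e) \<in> steps c" using \<alpha>[of q] by simp
  next
    assume e: "e \<in> arcs G \<and> (src e, tgt e) \<in> steps c"
    then have "\<alpha> (src e, tgt e) = e" using \<alpha>[of "(src e, tgt e)"] by (intro arc_eqI) auto
    with e show "e \<in> set p" unfolding p_def set_map steps_def by (metis image_eqI)
  qed
  have rev_p: "(\<exists>e'\<in>set p. reverse_arcs G e e') \<longleftrightarrow> (tgt e, src e) \<in> steps c" if "e \<in> arcs G" for e
  proof
    assume "(tgt e, src e) \<in> steps c"
    then show "\<exists>e'\<in>set p. reverse_arcs G e e'"
      using \<alpha>[of "(tgt e, src e)"] that by (intro bexI[of _ "\<alpha> (tgt e, src e)"])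
        (auto simp: set_p reverse_arcs_iff)
  qed (use that in \<open>auto simp: set_p reverse_arcs_iff\<close>)
  have "cycle p"
  proof -
    obtain x xs where c: "c = x # xs" using assms(2) by (cases c) auto
    have "map (tail G) p = map (\<lambda>q. \<phi> (fst q)) (zip c (rotate1 c))"
      unfolding p_def map_map
    proof (rule map_cong[OF refl])
      fix q assume "q \<in> set (zip c (rotate1 c))"
      then have "q \<in> steps c" by (simp add: steps_def)
      then show "(tail G \<circ> \<alpha>) q = \<phi> (fst q)" using \<alpha>[of q] \<phi>_src[of "\<alpha> q"] by simp
    qed
    also have "\<dots> = map \<phi> (map fst (zip c (rotate1 c)))" by (simp only: map_map comp_def)
    finally have tails: "map (tail G) p = map \<phi> c" by simp
    \<comment> \<open>The end \<open>y\<close> is decoupled from the start so that the induction can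
      move the start; taking \<open>y\<close> to be \<open>x\<close> then closes the walk, as
      \<open>rotate1\<close> moves \<open>x\<close> to the end.\<close>
    have cas: "cas (\<phi> x) (map \<alpha> (zip (x # xs) (xs @ [y]))) (\<phi> y)"
      if "set (zip (x # xs) (xs @ [y])) \<subseteq> steps c" for x xs y
      using that
    proof (induction xs arbitrary: x)
      case Nil
      then show ?case using \<alpha>[of "(x, y)"] \<phi>_src[of "\<alpha> (x, y)"] \<phi>_tgt[of "\<alpha> (x, y)"] by auto
    next
      case (Cons z zs)
      have "(x, z) \<in> steps c" using Cons.prems by simp
      then have "tail G (\<alpha> (x, z)) = \<phi> x" "head G (\<alpha> (x, z)) = \<phi> z"
        using \<alpha>[of "(x, z)"] \<phi>_src[of "\<alpha> (x, z)"] \<phi>_tgt[of "\<alpha> (x, z)"] by auto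
      moreover have "cas (\<phi> z) (map \<alpha> (zip (z # zs) (zs @ [y]))) (\<phi> y)"
        using Cons.prems by (intro Cons.IH) simp
      ultimately show ?case by simp
    qed
    have p_cas: "cas (\<phi> x) p (\<phi> x)"
      using cas[of x xs x] by (simp add: p_def steps_def c)
    have "p \<noteq> []" unfolding p_def c by simp
    have "awlast (\<phi> x) p = \<phi> x" using p_cas by (rule awlast_if_cas)
    then have walk_verts: "awalk_verts (\<phi> x) p = map \<phi> c @ [\<phi> x]"
      using \<open>p \<noteq> []\<close> tails by (simp add: awalk_verts_conv)
    have "set c \<subseteq> {..<n}"
    proof
      fix i assume "i \<in> set c"
      then obtain j where "(i, j) \<in> steps c"
        unfolding steps_def by (metis in_set_impl_in_set_zip1 length_rotate1)
      then show "i \<in> {..<n}" using steps increasing by fastforce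
    qed
    then have "inj_on \<phi> (set c)" "\<phi> x \<in> verts G"
      using bij_\<phi> c by (auto simp: bij_betw_def inj_on_def)
    \<comment> \<open>The start recurs as the last vertex, so distinctness concerns the vertices
      after the first.\<close>
    with assms(1) have "distinct (tl (awalk_verts (\<phi> x) p))"
      unfolding walk_verts c by (auto simp: distinct_map)
    with p_cas \<open>p \<noteq> []\<close> \<open>\<phi> x \<in> verts G\<close> show ?thesis
      unfolding cycle_def awalk_def using set_p by blast
  qed
  moreover have "3 \<le> length p" using assms(2) by (simp add: p_def)
  \<comment> \<open>No step is traversed in both directions, so at most one term of
    \<open>cycle_flow\<close> is nonzero and the case distinction is unambiguous.\<close>
  moreover have "lift (\<lambda>p. cycle_flow c p) e =
      (if e \<in> E \<and> e \<in> set p then 1 else if e \<in> E \<and> (\<exists>e'\<in>set p. reverse_arcs G e e') then -1 else 0)" for e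
    using E_subset_arcs[of e] rev_p[of e] set_p[of e] steps[of "src e" "tgt e"]
    by (auto simp: lift_def sign_def edge_def cycle_flow_def min_def max_def)
  ultimately show ?thesis unfolding encodes_directed_cycle_def by blast
qed

text \<open>The hypotheses involve only \<open>n\<close>, \<open>A\<close>, \<open>cs\<close> and
  \<open>M\<close>, so one finite certificate serves every numbered graph with these edges and every
  orientation. The last one asks that a linear system over the reals have only the zero solution;
  the others concern integers.\<close>

lemma ex_cycle_M_basis:
  fixes cs :: "nat list list" and M :: "nat \<Rightarrow> nat \<times> nat \<Rightarrow> int"
  assumes cycles: "\<forall>c\<in>set cs. distinct c \<and> 3 \<le> length c \<and>
      (\<forall>(i, j)\<in>steps c. (j, i) \<notin> steps c \<and> ((i, j) \<in> A \<or> (j, i) \<in> A))"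
    and conservation: "\<forall>c\<in>set cs. \<forall>v<n. (\<Sum>p\<in>A. net v p * cycle_flow c p) = 0"
    and obtuse: "\<forall>i<length cs. \<forall>j<length cs. i \<noteq> j \<longrightarrow>
      (\<Sum>p\<in>A. cycle_flow (cs ! i) p * cycle_flow (cs ! j) p) \<le> 0"
    and dual: "\<forall>i<length cs. \<forall>j<length cs.
      (\<Sum>p\<in>A. M i p * cycle_flow (cs ! j) p) = (if i = j then 1 else 0)"
    and separating: "\<And>X :: nat \<times> nat \<Rightarrow> real. \<lbrakk>\<forall>v<n. (\<Sum>p\<in>A. net v p * X p) = 0;
      \<forall>i<length cs. (\<Sum>p\<in>A. M i p * X p) = 0\<rbrakk> \<Longrightarrow> \<forall>p\<in>A. X p = 0"
  shows "\<exists>fs. cycle_M_basis G E fs"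
proof -
  define fs where "fs = map (\<lambda>c. lift (\<lambda>p. cycle_flow c p)) cs"
  \<comment> \<open>This sign cancels the one in \<open>lift\<close>, so \<open>m i\<close> pairs
    with lifted vectors as \<open>M i\<close> does with the originals.\<close>
  define m where "m i e = sign e * M i (edge e)" for i e
  have pairing: "(\<Sum>e\<in>E. m i e * lift X e) = (\<Sum>p\<in>A. M i p * X p)" for i and X :: "nat \<times> nat \<Rightarrow> real"
    unfolding sum_lift[symmetric] by (intro sum.cong refl) (simp add: m_def lift_def)
  have dual_fs: "dual_functionals E fs m"
    unfolding dual_functionals_def
  proof (intro allI impI)
    fix i j assume ij: "i < length fs" "j < length fs"
    have "(\<Sum>e\<in>E. m i e * (fs ! j) e) = real_of_int (\<Sum>p\<in>A. M i p * cycle_flow (cs ! j) p)"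
      using ij by (simp add: fs_def pairing)
    also have "\<dots> = real_of_int (if i = j then 1 else 0)"
      using dual ij by (simp add: fs_def del: of_int_sum)
    finally show "(\<Sum>e\<in>E. m i e * (fs ! j) e) = (if i = j then 1 else 0)" by simp
  qed
  have "integral_flow_basis G E fs"
  proof (rule integral_flow_basis_if_dual_functionals[OF _ dual_fs])
    show "set fs \<subseteq> integral_flows G E"
    proof
      fix f assume "f \<in> set fs"
      then obtain c where c: "c \<in> set cs" "f = lift (\<lambda>p. cycle_flow c p)"
        by (auto simp: fs_def)
      have "(\<Sum>p\<in>A. net v p * real_of_int (cycle_flow c p)) = 0" if "v < n" for v
        using conservation[rule_format, OF c(1) that, THEN arg_cong[where f = real_of_int]] by simp
      then show "f \<in> integral_flows G E"
        unfolding c(2) lift_in_integral_flows_iff by simp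
    qed
  next
    fix f :: "'b \<Rightarrow> real" and e
    assume f: "f \<in> integral_flows G E" "\<forall>i<length fs. (\<Sum>e\<in>E. m i e * f e) = 0" and "e \<in> E"
    then obtain X where X: "f = lift X"
      using ex_lift unfolding integral_flows_def by blast
    have "\<forall>p\<in>A. X p = 0"
      using f unfolding X pairing lift_in_integral_flows_iff
      by (intro separating) (auto simp: fs_def)
    then show "f e = 0"
      using \<open>e \<in> E\<close> bij_betw_edge unfolding X by (auto simp: lift_def bij_betw_def)
  qed
  moreover have "M_matrix (dual_Laplacian E fs)"
  proof (rule M_matrix_dual_Laplacian[OF dual_fs finite_E])
    fix i j assume ij: "i < length fs" "j < length fs" "i \<noteq> j"
    have "(\<Sum>e\<in>E. (fs ! i) e * (fs ! j) e) =
        real_of_int (\<Sum>p\<in>A. cycle_flow (cs ! i) p * cycle_flow (cs ! j) p)"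
      using ij by (simp add: fs_def sum_lift)
    also have "\<dots> \<le> 0"
      unfolding of_int_le_0_iff using obtuse ij by (simp add: fs_def)
    finally show "(\<Sum>e\<in>E. (fs ! i) e * (fs ! j) e) \<le> 0" .
  qed
  moreover have "encodes_directed_cycle G E f" if "f \<in> set fs" for f
    using that cycles encodes_directed_cycle_lift by (fastforce simp: fs_def)
  ultimately show ?thesis
    unfolding cycle_M_basis_def integral_flow_M_basis_def by blast
qed

end

section \<open>Finite certificates\<close>

text \<open>
  In a table \<open>D\<close>, the keys are the chords of a spanning tree, and the rows form the inverse of the
  matrix of the values of the basis cycles on these chords; it is integral since the cycles form a
  \<open>\<int>\<close>-basis. The index \<open>i\<close> selects a column.
\<close>

definition chord_functional :: "((nat \<times> nat) \<times> int list) list \<Rightarrow> nat \<Rightarrow> nat \<times> nat \<Rightarrow> int" where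
  "chord_functional D i p = (case map_of D p of None \<Rightarrow> 0 | Some xs \<Rightarrow> xs ! i)"

text \<open>The bounds are the vertex numbers 5 and 6 and the flow ranks 10 - 5 + 1 = 6 and 9 - 6 +
  1 = 4.\<close>

lemma all_less_numerals:
  "(\<forall>i<4. P i) \<longleftrightarrow> P 0 \<and> P 1 \<and> P 2 \<and> P (3 :: nat)"
  "(\<forall>i<5. P i) \<longleftrightarrow> P 0 \<and> P 1 \<and> P 2 \<and> P 3 \<and> P (4 :: nat)"
  "(\<forall>i<6. P i) \<longleftrightarrow> P 0 \<and> P 1 \<and> P 2 \<and> P 3 \<and> P 4 \<and> P (5 :: nat)"
  by (simp_all add: numeral_eq_Suc All_less_Suc conj_ac)

section \<open>The complete graph on five vertices\<close>

definition K5_edges :: "(nat \<times> nat) list" where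
  "K5_edges = [(0,1), (0,2), (0,3), (0,4), (1,2), (1,3), (1,4), (2,3), (2,4), (3,4)]"

text \<open>A triangle, three quadrilaterals and two edge-disjoint Hamiltonian cycles. Any two that
  run along an edge in the same direction oppose each other on another edge, which cancels the
  positive contribution.\<close>

definition K5_cycles :: "nat list list" where
  "K5_cycles = [[0,1,2], [0,2,1,3], [0,3,2,4], [0,4,3,1], [0,2,3,1,4], [0,3,4,2,1]]"

definition K5_chords :: "((nat \<times> nat) \<times> int list) list" where
  "K5_chords =
    [((0,1), [ 1,  1,  0,  0, 0,  0]),
     ((0,2), [-2, -1,  0, -1, 0, -1]),
     ((1,2), [-2, -2,  0, -1, 0, -1]),
     ((1,4), [ 2,  1,  1,  1, 1,  1]),
     ((2,3), [ 0,  0, -1,  0, 0,  0]),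
     ((3,4), [-1, -1,  0, -1, 0,  0])]"

lemma K5_length: "length K5_cycles = 6"
  by (simp add: K5_cycles_def)

lemma K5_nth:
  "K5_cycles ! 0 = [0,1,2]" "K5_cycles ! 1 = [0,2,1,3]" "K5_cycles ! 2 = [0,3,2,4]"
  "K5_cycles ! 3 = [0,4,3,1]" "K5_cycles ! 4 = [0,2,3,1,4]" "K5_cycles ! 5 = [0,3,4,2,1]"
  by (simp_all add: K5_cycles_def)

text \<open>Polymorphic because it expands both integer sums and the real sums in
  \<open>K5_separating\<close>.\<close>

lemma K5_sum:
  fixes f :: "nat \<times> nat \<Rightarrow> 'a::comm_monoid_add"
  shows "(\<Sum>p\<in>set K5_edges. f p) = f (0,1) + (f (0,2) + (f (0,3) + (f (0,4) + (f (1,2) + (f (1,3)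
    + (f (1,4) + (f (2,3) + (f (2,4) + f (3,4)))))))))"
  by (simp add: K5_edges_def)

lemma K5_adjacent:
  "\<forall>i<5. \<forall>j<5. i \<noteq> j \<longleftrightarrow> (i, j) \<in> set K5_edges \<or> (j, i) \<in> set K5_edges"
  by (simp add: K5_edges_def all_less_numerals)

lemma K5_cycles:
  "\<forall>c\<in>set K5_cycles. distinct c \<and> 3 \<le> length c \<and>
     (\<forall>(i, j)\<in>steps c. (j, i) \<notin> steps c \<and> ((i, j) \<in> set K5_edges \<or> (j, i) \<in> set K5_edges))"
  by (simp add: K5_cycles_def K5_edges_def steps_def)

lemma K5_conservation:
  "\<forall>c\<in>set K5_cycles. \<forall>v<5. (\<Sum>p\<in>set K5_edges. net v p * cycle_flow c p) = 0"
  unfolding K5_cycles_def set_simps ball_simps all_less_numerals K5_sum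
  by (simp add: steps_def net_def cycle_flow_def)

lemma K5_obtuse:
  "\<forall>i<length K5_cycles. \<forall>j<length K5_cycles. i \<noteq> j \<longrightarrow>
     (\<Sum>p\<in>set K5_edges. cycle_flow (K5_cycles ! i) p * cycle_flow (K5_cycles ! j) p) \<le> 0"
  unfolding K5_length all_less_numerals K5_nth K5_sum
  by (simp add: steps_def cycle_flow_def)

lemma K5_dual:
  "\<forall>i<length K5_cycles. \<forall>j<length K5_cycles.
     (\<Sum>p\<in>set K5_edges. chord_functional K5_chords i p * cycle_flow (K5_cycles ! j) p) =
       (if i = j then 1 else 0)"
  unfolding K5_length all_less_numerals K5_nth K5_sum
  by (simp add: steps_def cycle_flow_def chord_functional_def K5_chords_def)

text \<open>The table is invertible, so the functionals force \<open>X\<close> to vanish on the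
  chords. The other edges form the path 1-3-0-4-2, along which conservation propagates 0 from the
  ends.\<close>

lemma K5_separating:
  fixes X :: "nat \<times> nat \<Rightarrow> real"
  assumes "\<forall>v<5. (\<Sum>p\<in>set K5_edges. net v p * X p) = 0"
    and "\<forall>i<length K5_cycles. (\<Sum>p\<in>set K5_edges. chord_functional K5_chords i p * X p) = 0"
  shows "\<forall>p\<in>set K5_edges. X p = 0"
  using assms
  unfolding K5_length all_less_numerals K5_sum
  unfolding K5_edges_def set_simps ball_simps
  by (simp add: net_def chord_functional_def K5_chords_def)

lemma K5_admits_cycle_M_basis:
  fixes G :: "('a, 'b) pre_digraph"
  assumes "K\<^bsub>5\<^esub> G"
  shows "admits_cycle_M_basis G"
  unfolding admits_cycle_M_basis_def
proof (intro allI impI)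
  fix E assume E: "orientation G E"
  interpret graph G using assms by (simp add: complete_digraph_def)
  have "card (verts G) = 5" using assms by (simp add: complete_digraph_def)
  \<comment> \<open>Any numbering works, since all distinct vertices are adjacent.\<close>
  then obtain \<phi> :: "nat \<Rightarrow> 'a" where \<phi>: "bij_betw \<phi> {..<5} (verts G)"
    using ex_bij_betw_nat_finite[of "verts G"] by (auto simp: lessThan_atLeast0)
  interpret labelled_orientation G E 5 \<phi> "set K5_edges"
  proof
    fix i j :: nat assume ij: "i < 5" "j < 5"
    have "\<phi> i \<rightarrow>\<^bsub>G\<^esub> \<phi> j \<longleftrightarrow> i \<noteq> j"
      using assms ij \<phi> by (auto simp: complete_digraph_def bij_betw_def inj_on_def)
    also have "\<dots> \<longleftrightarrow> (i, j) \<in> set K5_edges \<or> (j, i) \<in> set K5_edges"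
      using K5_adjacent ij by blast
    finally show "\<phi> i \<rightarrow>\<^bsub>G\<^esub> \<phi> j \<longleftrightarrow> (i, j) \<in> set K5_edges \<or> (j, i) \<in> set K5_edges" .
  qed (use E \<phi> in \<open>auto simp: K5_edges_def\<close>)
  show "\<exists>fs. cycle_M_basis G E fs"
    using K5_cycles K5_conservation K5_obtuse K5_dual K5_separating by (rule ex_cycle_M_basis)
qed

section \<open>The complete bipartite graph with parts of size three\<close>

definition K33_edges :: "(nat \<times> nat) list" where
  "K33_edges = [(0,3), (0,4), (0,5), (1,3), (1,4), (1,5), (2,3), (2,4), (2,5)]"

text \<open>Three quadrilaterals and a Hamiltonian hexagon. The hexagon agrees in direction with the
  second and the third quadrilateral on one edge each and opposes each of them on another
  edge.\<close>

definition K33_cycles :: "nat list list" where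
  "K33_cycles = [[0,3,1,4], [0,4,1,5], [0,5,2,3], [0,4,2,5,1,3]]"

definition K33_chords :: "((nat \<times> nat) \<times> int list) list" where
  "K33_chords =
    [((0,4), [ 0,  1, 0,  0]),
     ((1,3), [-1, -1, 0,  0]),
     ((2,3), [ 0,  0, 1,  0]),
     ((2,4), [-1,  0, 0, -1])]"

lemma K33_length: "length K33_cycles = 4"
  by (simp add: K33_cycles_def)

lemma K33_nth:
  "K33_cycles ! 0 = [0,3,1,4]" "K33_cycles ! 1 = [0,4,1,5]"
  "K33_cycles ! 2 = [0,5,2,3]" "K33_cycles ! 3 = [0,4,2,5,1,3]"
  by (simp_all add: K33_cycles_def)

lemma K33_sum:
  fixes f :: "nat \<times> nat \<Rightarrow> 'a::comm_monoid_add"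
  shows "(\<Sum>p\<in>set K33_edges. f p) = f (0,3) + (f (0,4) + (f (0,5) + (f (1,3) + (f (1,4)
    + (f (1,5) + (f (2,3) + (f (2,4) + f (2,5))))))))"
  by (simp add: K33_edges_def)

lemma K33_adjacent:
  "\<forall>i<6. \<forall>j<6. (i < 3) \<noteq> (j < 3) \<longleftrightarrow> (i, j) \<in> set K33_edges \<or> (j, i) \<in> set K33_edges"
  by (simp add: K33_edges_def all_less_numerals)

lemma K33_cycles:
  "\<forall>c\<in>set K33_cycles. distinct c \<and> 3 \<le> length c \<and>
     (\<forall>(i, j)\<in>steps c. (j, i) \<notin> steps c \<and> ((i, j) \<in> set K33_edges \<or> (j, i) \<in> set K33_edges))"
  by (simp add: K33_cycles_def K33_edges_def steps_def)

lemma K33_conservation: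
  "\<forall>c\<in>set K33_cycles. \<forall>v<6. (\<Sum>p\<in>set K33_edges. net v p * cycle_flow c p) = 0"
  unfolding K33_cycles_def set_simps ball_simps all_less_numerals K33_sum
  by (simp add: steps_def net_def cycle_flow_def)

lemma K33_obtuse:
  "\<forall>i<length K33_cycles. \<forall>j<length K33_cycles. i \<noteq> j \<longrightarrow>
     (\<Sum>p\<in>set K33_edges. cycle_flow (K33_cycles ! i) p * cycle_flow (K33_cycles ! j) p) \<le> 0"
  unfolding K33_length all_less_numerals K33_nth K33_sum
  by (simp add: steps_def cycle_flow_def)

lemma K33_dual:
  "\<forall>i<length K33_cycles. \<forall>j<length K33_cycles.
     (\<Sum>p\<in>set K33_edges. chord_functional K33_chords i p * cycle_flow (K33_cycles ! j) p) =
       (if i = j then 1 else 0)"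
  unfolding K33_length all_less_numerals K33_nth K33_sum
  by (simp add: steps_def cycle_flow_def chord_functional_def K33_chords_def)

text \<open>Once the chords vanish, the tree with edges 03, 05, 14, 15, 25 remains. Conservation at
  the leaves 2, 3, 4 clears three edges, and then at 0 and 1 the other two.\<close>

lemma K33_separating:
  fixes X :: "nat \<times> nat \<Rightarrow> real"
  assumes "\<forall>v<6. (\<Sum>p\<in>set K33_edges. net v p * X p) = 0"
    and "\<forall>i<length K33_cycles. (\<Sum>p\<in>set K33_edges. chord_functional K33_chords i p * X p) = 0"
  shows "\<forall>p\<in>set K33_edges. X p = 0"
  using assms
  unfolding K33_length all_less_numerals K33_sum
  unfolding K33_edges_def set_simps ball_simps
  by (simp add: net_def chord_functional_def K33_chords_def)

lemma K33_admits_cycle_M_basis: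
  fixes G :: "('a, 'b) pre_digraph"
  assumes "K\<^bsub>3,3\<^esub> G"
  shows "admits_cycle_M_basis G"
  unfolding admits_cycle_M_basis_def
proof (intro allI impI)
  fix E assume E: "orientation G E"
  interpret graph G using assms by (simp add: complete_bipartite_digraph_def)
  obtain U V where UV: "verts G = U \<union> V" "U \<inter> V = {}" "card U = 3" "card V = 3"
      "arcs_ends G = U \<times> V \<union> V \<times> U"
    using assms unfolding complete_bipartite_digraph_def by blast
  \<comment> \<open>An infinite set has \<open>card\<close> 0, so cardinality 3 implies
    finiteness.\<close>
  then have "finite U" "finite V" by (metis card.infinite zero_neq_numeral)+
  then obtain f g :: "nat \<Rightarrow> 'a" where f: "bij_betw f {..<3} U" and g: "bij_betw g {..<3} V"
    using ex_bij_betw_nat_finite[of U] ex_bij_betw_nat_finite[of V] UV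
    by (auto simp: lessThan_atLeast0)
  \<comment> \<open>Labels below 3 go to \<open>U\<close> and the others to \<open>V\<close>, so
    adjacency means lying on different sides of 3.\<close>
  define \<phi> where "\<phi> i = (if i < 3 then f i else g (i - 3))" for i
  have "bij_betw \<phi> ({..<3} \<union> {3..<6}) (U \<union> V)"
  proof (rule bij_betw_combine[OF _ _ UV(2)])
    show "bij_betw \<phi> {..<3} U"
      using f by (rule bij_betw_cong[THEN iffD1, rotated]) (simp add: \<phi>_def)
    have "bij_betw (\<lambda>i. i - 3) {3..<6} {..<3::nat}"
      by (rule bij_betw_byWitness[where f' = "\<lambda>i. i + 3"]) auto
    then have "bij_betw (g \<circ> (\<lambda>i. i - 3)) {3..<6} V"
      using g by (rule bij_betw_trans)
    then show "bij_betw \<phi> {3..<6} V"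
      by (rule bij_betw_cong[THEN iffD1, rotated]) (simp add: \<phi>_def)
  qed
  moreover have "{..<3} \<union> {3..<6} = {..<6::nat}" by auto
  ultimately have \<phi>: "bij_betw \<phi> {..<6} (verts G)" using UV(1) by simp
  interpret labelled_orientation G E 6 \<phi> "set K33_edges"
  proof
    fix i j :: nat assume ij: "i < 6" "j < 6"
    have side: "\<phi> k \<in> U \<longleftrightarrow> k < 3" "\<phi> k \<in> V \<longleftrightarrow> \<not> k < 3" if "k < 6" for k
    proof -
      have "\<phi> k \<in> (if k < 3 then U else V)"
        using f g that by (auto simp: \<phi>_def bij_betw_def)
      then show "\<phi> k \<in> U \<longleftrightarrow> k < 3" "\<phi> k \<in> V \<longleftrightarrow> \<not> k < 3" using UV(2) by (auto split: if_splits)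
    qed
    have "\<phi> i \<rightarrow>\<^bsub>G\<^esub> \<phi> j \<longleftrightarrow> (i < 3) \<noteq> (j < 3)"
      using UV(5) side ij by auto
    also have "\<dots> \<longleftrightarrow> (i, j) \<in> set K33_edges \<or> (j, i) \<in> set K33_edges"
      using K33_adjacent ij by blast
    finally show "\<phi> i \<rightarrow>\<^bsub>G\<^esub> \<phi> j \<longleftrightarrow> (i, j) \<in> set K33_edges \<or> (j, i) \<in> set K33_edges" .
  qed (use E \<phi> in \<open>auto simp: K33_edges_def\<close>)
  show "\<exists>fs. cycle_M_basis G E fs"
    using K33_cycles K33_conservation K33_obtuse K33_dual K33_separating by (rule ex_cycle_M_basis)
qed

theorem proposition4p3:
  fixes G :: "('a, 'b) pre_digraph" and H :: "('c, 'd) pre_digraph"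
  shows "(K\<^bsub>5\<^esub> G \<longrightarrow> admits_cycle_M_basis G) \<and> (K\<^bsub>3,3\<^esub> H \<longrightarrow> admits_cycle_M_basis H)"
  using K5_admits_cycle_M_basis K33_admits_cycle_M_basis by blast

end
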